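(* Let $a,b,c,d$ be circles in the plane with centers $A,B,C,D$, and suppose $abc\to d$ is tight. Use the following labeling on the boundary circle $\mathrm{Circ}(d)$ of $d$: for $x\in\{a,b,c\}$ with center $X$, let $X_0$ be the point where the ray from $D$ through $X$ meets $\mathrm{Circ}(d)$, and let $X_1,X_2$ be the touching points on $\mathrm{Circ}(d)$ of the two common tangent lines of $x$ and $d$. Assume the orientation is such that $B_0,A_0,C_0$ occur in counterclockwise circular order on $\mathrm{Circ}(d)$, and the indices are chosen so that walking counterclockwise one meets $B_1,B_0,B_2$ in this order, $A_1,A_0,A_2$ in this order, and $C_2,C_0,C_1$ in this order. Then the counterclockwise order of points on $\mathrm{Circ}(d)$ beginning at $B_1$ is $B_1, C_1, A_1, B_2, C_2, A_2$.
   Context: A circle means a closed disc in $\mathbb{R}^2$ (boundary included), possibly of radius $0$; a circle is identified with its point set. For a set $Y$ of circles (written as a word), the implication $Y\to u$ means $u\subseteq\mathrm{CH}(Y)$, where $\mathrm{CH}(Y)$ is the convex hull of the union of the point sets; it is tight if it holds and $u\not\subseteq\mathrm{CH}(Y\setminus\{z\})$ for every $z\in Y$. *)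

theory Defs
  imports "HOL-Analysis.Analysis"
begin

text \<open>
  The oriented Euclidean plane is modelled by the type \<^typ>\<open>complex\<close>. A circle is a closed disc
  \<open>cball X r\<close> with \<open>0 \<le> r\<close>, identified with its point set; \<open>sphere X r\<close> is its boundary circle.
\<close>

definition circ_implies :: "complex set set \<Rightarrow> complex set \<Rightarrow> bool" where
  "circ_implies Y u \<longleftrightarrow> u \<subseteq> convex hull (\<Union> Y)"

definition circ_implies_tight :: "complex set set \<Rightarrow> complex set \<Rightarrow> bool" where
  "circ_implies_tight Y u \<longleftrightarrow> circ_implies Y u \<and> (\<forall>z\<in>Y. \<not> circ_implies (Y - {z}) u)"

definition ray_through :: "complex \<Rightarrow> complex \<Rightarrow> complex set" where
  "ray_through P X = {P + t *\<^sub>R (X - P) | t. 0 \<le> t}"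

text \<open>
  A line touches a disc at the only point they have in common; for a disc of radius \<open>0\<close> this means
  that the line passes through the centre.
\<close>

definition touches_at :: "complex set \<Rightarrow> complex set \<Rightarrow> complex \<Rightarrow> bool" where
  "touches_at L x p \<longleftrightarrow> L \<inter> x = {p}"

text \<open>
  The two common tangent lines of two circles, neither of which contains the other, are the outer
  ones, with both circles on the same side. (Disjoint circles of positive radius also have two
  inner common tangents, which separate them.)
\<close>

definition outer_common_tangent :: "complex set \<Rightarrow> complex set \<Rightarrow> complex set \<Rightarrow> bool" where
  "outer_common_tangent L x y \<longleftrightarrow>
     (\<exists>p. touches_at L x p) \<and> (\<exists>q. touches_at L y q) \<and>
     (\<exists>n k. n \<noteq> 0 \<and> L = {z. n \<bullet> z = k} \<and> x \<union> y \<subseteq> {z. n \<bullet> z \<le> k})"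

definition tangent_points :: "complex set \<Rightarrow> complex set \<Rightarrow> complex set" where
  "tangent_points x d = {p. \<exists>L. outer_common_tangent L x d \<and> touches_at L d p}"

text \<open>The angle in \<open>[0, 2\<pi>)\<close> by which one turns counterclockwise about \<open>Z\<close> from \<open>P\<close> to \<open>Q\<close>.\<close>

definition ccw_angle :: "complex \<Rightarrow> complex \<Rightarrow> complex \<Rightarrow> real" where
  "ccw_angle Z P Q = Arg2pi ((Q - Z) / (P - Z))"

text \<open>
  Strict circular order; in particular the points of a circle with centre \<open>Z\<close> that satisfy it are
  distinct and the circle has positive radius.
\<close>

definition ccw_order :: "complex \<Rightarrow> complex \<Rightarrow> complex \<Rightarrow> complex \<Rightarrow> bool" where
  "ccw_order Z P Q R \<longleftrightarrow> 0 < ccw_angle Z P Q \<and> ccw_angle Z P Q < ccw_angle Z P R"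

text \<open>
  The order of the six points met on a counterclockwise walk of less than a full turn starting at
  \<open>P1\<close>. The points of the pairs \<open>P1, P2\<close> and \<open>P3, P4\<close> and \<open>P5, P6\<close> may coincide: already for a
  triangle (three circles of radius \<open>0\<close>) and its incircle, each side of the triangle is a common
  tangent for two of the vertices, and its point of contact carries two labels.
\<close>

definition ccw_order6 ::
  "complex \<Rightarrow> complex \<Rightarrow> complex \<Rightarrow> complex \<Rightarrow> complex \<Rightarrow> complex \<Rightarrow> complex \<Rightarrow> bool" where
  "ccw_order6 Z P1 P2 P3 P4 P5 P6 \<longleftrightarrow>
     ccw_angle Z P1 P1 \<le> ccw_angle Z P1 P2 \<and>
     ccw_angle Z P1 P2 < ccw_angle Z P1 P3 \<and>
     ccw_angle Z P1 P3 \<le> ccw_angle Z P1 P4 \<and>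
     ccw_angle Z P1 P4 < ccw_angle Z P1 P5 \<and>
     ccw_angle Z P1 P5 \<le> ccw_angle Z P1 P6"

end

theory Submission imports Defs begin

text \<open>
  Compare support functions. For a unit vector \<open>e\<close>, the disc \<open>x\<close> reaches at least as far as \<open>d\<close> in
  direction \<open>e\<close> iff \<open>e\<close> lies in a closed arc of directions that is centred at \<open>X\<^sub>0\<close> and ends at
  \<open>X\<^sub>1\<close> and \<open>X\<^sub>2\<close>. The implication \<open>abc \<rightarrow> d\<close> says that the three arcs cover the circle of
  directions, tightness says that no two of them do. In such a minimal cover cyclically
  consecutive arcs overlap, and any two arcs leave a gap on the side of the third one.
\<close>

section \<open>Support functions of discs\<close>

lemma inner_le_cball:
  fixes e X y :: "'a::real_inner"
  assumes "norm e = 1" "y \<in> cball X r"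
  shows "e \<bullet> y \<le> e \<bullet> X + r"
proof -
  have "e \<bullet> (y - X) \<le> norm e * norm (y - X)"
    by (rule norm_cauchy_schwarz)
  also have "\<dots> \<le> r"
    using assms by (simp add: dist_norm norm_minus_commute)
  finally show ?thesis
    by (simp add: inner_diff_right)
qed

lemma inner_unit_self:
  fixes e :: "'a::real_inner"
  assumes "norm e = 1"
  shows "e \<bullet> e = 1"
  using assms by (simp add: dot_square_norm)

text \<open>Equality case of Cauchy-Schwarz: for \<open>v = y - X\<close>, the squared norm of
  \<open>v - r *\<^sub>R e\<close> expands to at most r^2 - 2 r^2 + r^2 = 0.\<close>

lemma cball_inner_eq_max:
  fixes e X y :: "'a::real_inner"
  assumes e: "norm e = 1" and y: "y \<in> cball X r" and eq: "e \<bullet> y = e \<bullet> X + r"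
  shows "y = X + r *\<^sub>R e"
proof -
  let ?v = "y - X"
  have v: "e \<bullet> ?v = r"
    using eq by (simp add: inner_diff_right)
  have "norm ?v \<le> r"
    using y by (simp add: dist_norm norm_minus_commute)
  then have "?v \<bullet> ?v \<le> r * r"
    by (metis norm_ge_zero mult_mono' dot_square_norm power2_eq_square)
  moreover have "(u - r *\<^sub>R e) \<bullet> (u - r *\<^sub>R e) = u \<bullet> u - 2 * r * (e \<bullet> u) + r * r * (e \<bullet> e)" for u
    by (simp add: inner_diff_left inner_diff_right inner_commute[of u e] algebra_simps)
  ultimately have "(?v - r *\<^sub>R e) \<bullet> (?v - r *\<^sub>R e) \<le> 0"
    by (simp add: v inner_unit_self[OF e])
  then have "?v - r *\<^sub>R e = 0"
    by (metis inner_eq_zero_iff inner_ge_zero order_antisym)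
  then show ?thesis
    by (simp add: algebra_simps)
qed

text \<open>The support function of the hull in direction \<open>e\<close> is the maximum of
  \<open>e \<bullet> X + r\<close> over \<open>I\<close>. If all discs of \<open>I\<close> fall
  short in direction \<open>e\<close>, an open half-plane contains the hull but not the extreme
  point of \<open>cball D rd\<close>; conversely, a point outside the closed hull is separated from
  it.\<close>

lemma cball_subset_convex_hull_iff:
  fixes D :: "'a::euclidean_space" and I :: "('a \<times> real) set"
  assumes "finite I" "I \<noteq> {}" and r: "\<And>X r. (X, r) \<in> I \<Longrightarrow> 0 \<le> r" and "0 \<le> rd"
  shows "cball D rd \<subseteq> convex hull (\<Union>(X, r)\<in>I. cball X r) \<longleftrightarrow>
    (\<forall>e. norm e = 1 \<longrightarrow> (\<exists>(X, r)\<in>I. e \<bullet> D + rd \<le> e \<bullet> X + r))"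
    (is "?L \<longleftrightarrow> ?R")
proof
  assume L: ?L
  show ?R
  proof (intro allI impI, rule ccontr)
    fix e :: 'a
    assume e: "norm e = 1" and "\<not> (\<exists>(X, r)\<in>I. e \<bullet> D + rd \<le> e \<bullet> X + r)"
    then have "(\<Union>(X, r)\<in>I. cball X r) \<subseteq> {y. e \<bullet> y < e \<bullet> D + rd}"
      using inner_le_cball[OF e] by fastforce
    then have "convex hull (\<Union>(X, r)\<in>I. cball X r) \<subseteq> {y. e \<bullet> y < e \<bullet> D + rd}"
      by (simp add: hull_minimal convex_halfspace_lt)
    moreover have "D + rd *\<^sub>R e \<in> cball D rd"
      using e \<open>0 \<le> rd\<close> by (simp add: dist_norm)
    ultimately have "D + rd *\<^sub>R e \<in> {y. e \<bullet> y < e \<bullet> D + rd}"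
      using L by blast
    then show False
      using e by (simp add: inner_add_right inner_unit_self)
  qed
next
  assume R: ?R
  let ?H = "convex hull (\<Union>(X, r)\<in>I. cball X r)"
  have "compact (\<Union>(X, r)\<in>I. cball X r)"
    using \<open>finite I\<close> by (intro compact_UN) auto
  then have closed: "closed ?H"
    by (simp add: compact_imp_closed compact_convex_hull)
  show ?L
  proof (rule ccontr)
    assume "\<not> ?L"
    then obtain z where z: "z \<in> cball D rd" "z \<notin> ?H"
      by blast
    obtain n k where n: "n \<bullet> z < k" "\<forall>x\<in>?H. k < n \<bullet> x"
      using separating_hyperplane_closed_point[OF convex_convex_hull closed z(2)] by blast
    obtain X0 r0 where I0: "(X0, r0) \<in> I"
      using \<open>I \<noteq> {}\<close> by auto
    have hull: "y \<in> ?H" if "(X, r) \<in> I" "y \<in> cball X r" for X r y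
      using that by (intro hull_inc) blast
    have "X0 \<in> ?H"
      using hull[OF I0] r[OF I0] by simp
    then have "n \<noteq> 0"
      using n by force
    \<comment> \<open>The hull lies on the side where \<open>n\<close> is large, so the direction in
      which \<open>z\<close> exceeds it is opposite to \<open>n\<close>.\<close>
    define e where "e = - (n /\<^sub>R norm n)"
    have e: "norm e = 1"
      using \<open>n \<noteq> 0\<close> by (simp add: e_def)
    obtain X r where Xr: "(X, r) \<in> I" and le: "e \<bullet> D + rd \<le> e \<bullet> X + r"
      using R e by blast
    have "X + r *\<^sub>R e \<in> ?H"
      using hull[OF Xr] r[OF Xr] e by (simp add: dist_norm)
    then have "n \<bullet> z < n \<bullet> (X + r *\<^sub>R e)"
      using n by force
    then have "e \<bullet> (X + r *\<^sub>R e) < e \<bullet> z"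
      using \<open>n \<noteq> 0\<close> by (simp add: e_def divide_inverse_commute[symmetric] divide_strict_right_mono)
    then have "e \<bullet> X + r < e \<bullet> z"
      using e by (simp add: inner_add_right inner_unit_self)
    moreover have "e \<bullet> z \<le> e \<bullet> D + rd"
      using inner_le_cball[OF e z(1)] .
    ultimately show False
      using le by linarith
  qed
qed

section \<open>Common tangents and touching points\<close>

lemma touches_at_cball:
  assumes e: "norm e = 1" and "0 \<le> r" and "e \<bullet> X + r = k"
  shows "touches_at {z. e \<bullet> z = k} (cball X r) (X + r *\<^sub>R e)"
  unfolding touches_at_def
proof (intro equalityI subsetI)
  fix z
  assume "z \<in> {z. e \<bullet> z = k} \<inter> cball X r"
  then show "z \<in> {X + r *\<^sub>R e}"
    using cball_inner_eq_max[OF e] assms by auto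
qed (use assms in \<open>auto simp: inner_add_right inner_unit_self dist_norm\<close>)

text \<open>An outer common tangent with outer unit normal \<open>e\<close> is exactly a line at
  which both support functions in direction \<open>e\<close> agree. The touching points on
  \<open>d\<close> thus correspond to the directions where neither disc reaches farther.\<close>

lemma tangent_points_cball:
  assumes "0 \<le> r" "0 \<le> rd"
  shows "tangent_points (cball X r) (cball D rd) =
    {D + rd *\<^sub>R e | e. norm e = 1 \<and> e \<bullet> X + r = e \<bullet> D + rd}"
proof (intro equalityI subsetI)
  fix p
  assume "p \<in> tangent_points (cball X r) (cball D rd)"
  then obtain L q n k where p: "touches_at L (cball D rd) p" and q: "touches_at L (cball X r) q"
    and "n \<noteq> 0" and L: "L = {z. n \<bullet> z = k}" and le: "cball X r \<union> cball D rd \<subseteq> {z. n \<bullet> z \<le> k}"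
    unfolding tangent_points_def outer_common_tangent_def by blast
  define e where "e = n /\<^sub>R norm n"
  define l where "l = k / norm n"
  have e: "norm e = 1"
    using \<open>n \<noteq> 0\<close> by (simp add: e_def)
  have L': "L = {z. e \<bullet> z = l}"
    unfolding L e_def l_def using \<open>n \<noteq> 0\<close> by (auto simp: field_simps)
  have le': "cball X r \<union> cball D rd \<subseteq> {z. e \<bullet> z \<le> l}"
    using le \<open>n \<noteq> 0\<close> unfolding e_def l_def by (auto simp: field_simps)
  \<comment> \<open>The extreme point \<open>Y + s *\<^sub>R e\<close> cannot pass the line, and the
    touching point \<open>y\<close> lies on it.\<close>
  have height: "e \<bullet> Y + s = l"
    if "touches_at L (cball Y s) y" "0 \<le> s" "cball Y s \<subseteq> {z. e \<bullet> z \<le> l}" for Y s y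
  proof (rule antisym)
    have "Y + s *\<^sub>R e \<in> cball Y s"
      using e \<open>0 \<le> s\<close> by (simp add: dist_norm)
    then have "e \<bullet> (Y + s *\<^sub>R e) \<le> l"
      using that(3) by blast
    then show "e \<bullet> Y + s \<le> l"
      using e by (simp add: inner_add_right inner_unit_self)
    have "y \<in> cball Y s" "e \<bullet> y = l"
      using that(1) unfolding touches_at_def L' by auto
    then show "l \<le> e \<bullet> Y + s"
      using inner_le_cball[OF e] by metis
  qed
  have X: "e \<bullet> X + r = l" and D: "e \<bullet> D + rd = l"
    using height p q assms le' by blast+
  have "p = D + rd *\<^sub>R e"
    using p touches_at_cball[OF e \<open>0 \<le> rd\<close> D] unfolding touches_at_def L' by auto
  then show "p \<in> {D + rd *\<^sub>R e | e. norm e = 1 \<and> e \<bullet> X + r = e \<bullet> D + rd}"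
    using e X D by auto
next
  fix p
  assume "p \<in> {D + rd *\<^sub>R e | e. norm e = 1 \<and> e \<bullet> X + r = e \<bullet> D + rd}"
  then obtain e where p: "p = D + rd *\<^sub>R e" and e: "norm e = 1"
    and eq: "e \<bullet> X + r = e \<bullet> D + rd"
    by auto
  let ?L = "{z. e \<bullet> z = e \<bullet> D + rd}"
  have "e \<noteq> 0"
    using e by auto
  moreover have "cball X r \<union> cball D rd \<subseteq> {z. e \<bullet> z \<le> e \<bullet> D + rd}"
    using inner_le_cball[OF e, of _ X r] inner_le_cball[OF e, of _ D rd] eq by auto
  ultimately have "outer_common_tangent ?L (cball X r) (cball D rd)"
    unfolding outer_common_tangent_def
    using touches_at_cball[OF e \<open>0 \<le> r\<close> eq] touches_at_cball[OF e \<open>0 \<le> rd\<close> refl] by blast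
  then show "p \<in> tangent_points (cball X r) (cball D rd)"
    unfolding tangent_points_def p using touches_at_cball[OF e \<open>0 \<le> rd\<close> refl] by blast
qed

section \<open>Arcs of directions\<close>

text \<open>Closed arcs of half-width \<open>p\<close> are encoded by this cosine inequality, which
  avoids reducing angles modulo \<open>2 * pi\<close>. Subtracting the nearest multiple of
  \<open>2 * pi\<close> brings \<open>t\<close> into the range where cosine decreases in
  \<bar>t\<bar>.\<close>

lemma cos_ge_cos_iff:
  assumes "0 \<le> p" "p \<le> pi"
  shows "cos p \<le> cos t \<longleftrightarrow> (\<exists>k::int. \<bar>t - 2 * pi * k\<bar> \<le> p)"
proof -
  have shift: "cos \<bar>t - 2 * pi * of_int k\<bar> = cos t" for k :: int
    by (simp add: cos_diff)
  show ?thesis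
  proof
    assume *: "cos p \<le> cos t"
    define k where "k = round (t / (2 * pi))"
    have "\<bar>of_int k - t / (2 * pi)\<bar> \<le> 1 / 2"
      unfolding k_def by (rule of_int_round_abs_le)
    then have "\<bar>of_int k - t / (2 * pi)\<bar> * (2 * pi) \<le> 1 / 2 * (2 * pi)"
      by (intro mult_right_mono) auto
    moreover have "\<bar>of_int k - t / (2 * pi)\<bar> * (2 * pi) = \<bar>(of_int k - t / (2 * pi)) * (2 * pi)\<bar>"
      by (simp add: abs_mult)
    moreover have "(of_int k - t / (2 * pi)) * (2 * pi) = 2 * pi * k - t"
      by (simp add: field_simps)
    ultimately have "\<bar>t - 2 * pi * k\<bar> \<le> pi"
      by linarith
    then have "\<bar>t - 2 * pi * k\<bar> \<le> p"
      using * assms by (metis shift cos_mono_le_eq abs_ge_zero)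
    then show "\<exists>k::int. \<bar>t - 2 * pi * k\<bar> \<le> p" ..
  next
    assume "\<exists>k::int. \<bar>t - 2 * pi * k\<bar> \<le> p"
    then show "cos p \<le> cos t"
      using assms by (metis shift cos_monotone_0_pi_le abs_ge_zero)
  qed
qed

lemma cos_ge_cosI:
  assumes "\<bar>t\<bar> \<le> p \<or> \<bar>t - 2 * pi\<bar> \<le> p" "p \<le> pi"
  shows "cos p \<le> cos t"
proof -
  have "\<exists>k::int. \<bar>t - 2 * pi * k\<bar> \<le> p"
    using assms(1) by (auto intro: exI[of _ 0] exI[of _ 1])
  then show ?thesis
    using assms cos_ge_cos_iff[of p t] by auto
qed

lemma cos_ge_cosD:
  assumes "cos p \<le> cos t" "0 \<le> p" "p \<le> pi" "- (2 * pi) < t" "t < 2 * pi"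
  shows "\<bar>t\<bar> \<le> p \<or> 2 * pi - p \<le> t \<or> t \<le> p - 2 * pi"
proof -
  obtain k :: int where k: "\<bar>t - 2 * pi * k\<bar> \<le> p"
    using assms cos_ge_cos_iff by blast
  consider "k = 0" | "1 \<le> k" | "k \<le> -1"
    by linarith
  then show ?thesis
  proof cases
    case 2
    then have "2 * pi * 1 \<le> 2 * pi * k"
      by (intro mult_left_mono) auto
    then show ?thesis
      using k by linarith
  next
    case 3
    then have "2 * pi * k \<le> 2 * pi * (-1)"
      by (intro mult_left_mono) auto
    then show ?thesis
      using k by linarith
  qed (use k in auto)
qed

text \<open>Inclusion of arcs: the same translate \<open>k\<close> works for both centres, by the
  triangle inequality.\<close>

lemma cos_arc_mono:
  assumes "\<bar>s - t\<bar> + p \<le> q" "0 \<le> p" "q \<le> pi" "cos p \<le> cos (x - s)"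
  shows "cos q \<le> cos (x - t)"
proof -
  obtain k :: int where "\<bar>x - s - 2 * pi * k\<bar> \<le> p"
    using assms cos_ge_cos_iff[of p "x - s"] by auto
  then have "\<bar>x - t - 2 * pi * k\<bar> \<le> q"
    using assms by linarith
  then show ?thesis
    using assms cos_ge_cos_iff[of q "x - t"] by auto
qed

lemma cos_int_shift: "cos (t - 2 * pi * of_int k - s) = cos (t - s)"
proof -
  have "t - 2 * pi * of_int k - s = (t - s) - 2 * pi * of_int k"
    by simp
  then show ?thesis
    by (simp only: cos_diff[of "t - s"]) simp
qed

text \<open>Stated for one pair of neighbouring arcs, to be applied three times after cyclic
  rotation. The arcs are closed, so neighbours may share just an endpoint (\<open>\<le>\<close>),
  whereas the gap left by two arcs is open and nonempty (\<open><\<close>).\<close>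

lemma minimal_arc_cover:
  fixes t1 t2 t3 :: real
  assumes t: "t1 < t2" "t2 < t3" "t3 < t1 + 2 * pi"
    and p: "0 < p1" "p1 < pi" "0 < p2" "p2 < pi" "0 < p3" "p3 < pi"
    and cover: "\<And>x. cos p1 \<le> cos (x - t1) \<or> cos p2 \<le> cos (x - t2) \<or> cos p3 \<le> cos (x - t3)"
    and tight12: "\<exists>x. \<not> cos p1 \<le> cos (x - t1) \<and> \<not> cos p2 \<le> cos (x - t2)"
    and tight13: "\<exists>x. \<not> cos p1 \<le> cos (x - t1) \<and> \<not> cos p3 \<le> cos (x - t3)"
    and tight23: "\<exists>x. \<not> cos p2 \<le> cos (x - t2) \<and> \<not> cos p3 \<le> cos (x - t3)"
  shows "t2 - p2 \<le> t1 + p1" and "t2 + p2 < t1 - p1 + 2 * pi"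
proof -
  show overlap: "t2 - p2 \<le> t1 + p1"
  proof (rule ccontr)
    \<comment> \<open>A point of the gap lies in the third arc, which then contains one of the other two.\<close>
    assume gap: "\<not> t2 - p2 \<le> t1 + p1"
    \<comment> \<open>The other two bounds keep the point clear of arc 2 shifted back and arc 1
      shifted forward by a full turn.\<close>
    have "max (t1 + p1) (t2 - 2 * pi + p2) < min (t2 - p2) (t1 + 2 * pi - p1)"
      using gap t p by auto
    then obtain x where "max (t1 + p1) (t2 - 2 * pi + p2) < x" "x < min (t2 - p2) (t1 + 2 * pi - p1)"
      using dense by blast
    then have x: "t1 + p1 < x" "t2 - 2 * pi + p2 < x" "x < t2 - p2" "x < t1 + 2 * pi - p1"
      by auto
    have "\<not> cos p1 \<le> cos (x - t1)"
      using cos_ge_cosD[of p1 "x - t1"] x t p by auto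
    moreover have "\<not> cos p2 \<le> cos (x - t2)"
      using cos_ge_cosD[of p2 "x - t2"] x t p by auto
    ultimately have "cos p3 \<le> cos (x - t3)"
      using cover by blast
    \<comment> \<open>Arc 3 reaches \<open>x\<close> either backwards from \<open>t3\<close>,
      swallowing arc 2, or forwards from \<open>t3 - 2 * pi\<close>, swallowing arc 1.\<close>
    then have "t3 - p3 \<le> x \<or> x \<le> t3 + p3 - 2 * pi"
      using cos_ge_cosD[of p3 "x - t3"] x t p by auto
    then show False
    proof
      assume "t3 - p3 \<le> x"
      then have "\<bar>t2 - t3\<bar> + p2 \<le> p3"
        using x t by linarith
      then show False
        using cos_arc_mono[of t2 t3 p2 p3] cover tight13 p by (metis less_imp_le)
    next
      assume "x \<le> t3 + p3 - 2 * pi"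
      then have "\<bar>t1 - (t3 - 2 * pi)\<bar> + p1 \<le> p3"
        using x t by linarith
      then have "cos p3 \<le> cos (y - t3)" if "cos p1 \<le> cos (y - t1)" for y
        using cos_arc_mono[of t1 "t3 - 2 * pi" p1 p3 y] that p cos_int_shift[of y "-1" t3]
        by (simp add: algebra_simps)
      then show False
        using cover tight23 by metis
    qed
  qed
  obtain y where y: "\<not> cos p1 \<le> cos (y - t1)" "\<not> cos p2 \<le> cos (y - t2)"
    using tight12 by blast
  \<comment> \<open>Move the uncovered point into the full turn starting at \<open>t1\<close>. By
    the overlap it must then lie beyond \<open>t2 + p2\<close>, and before the next copy of arc
    1.\<close>
  define k where "k = \<lfloor>(y - t1) / (2 * pi)\<rfloor>"
  define x where "x = y - 2 * pi * k"
  have "of_int k \<le> (y - t1) / (2 * pi)" "(y - t1) / (2 * pi) < of_int k + 1"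
    unfolding k_def by linarith+
  then have x: "t1 \<le> x" "x < t1 + 2 * pi"
    unfolding x_def by (simp_all add: field_simps)
  have "\<not> cos p1 \<le> cos (x - t1)" "\<not> cos p2 \<le> cos (x - t2)"
    unfolding x_def cos_int_shift using y by auto
  then have "\<not> \<bar>x - t1\<bar> \<le> p1" "\<not> \<bar>x - t1 - 2 * pi\<bar> \<le> p1" "\<not> \<bar>x - t2\<bar> \<le> p2"
    using cos_ge_cosI[of "x - t1" p1] cos_ge_cosI[of "x - t2" p2] p by auto
  then show "t2 + p2 < t1 - p1 + 2 * pi"
    using overlap x t by linarith
qed

section \<open>Angles on the boundary circle\<close>

lemma ccw_angle_self: "ccw_angle Z P P = 0"
  by (cases "P = Z") (auto simp: ccw_angle_def Arg2pi_eq_0)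

lemma ccw_angle_cis:
  assumes "0 < r" "s \<le> t" "t < s + 2 * pi"
  shows "ccw_angle Z (Z + r *\<^sub>R cis s) (Z + r *\<^sub>R cis t) = t - s"
proof -
  have "(r *\<^sub>R cis t) / (r *\<^sub>R cis s) = cis (t - s)"
    using assms by (simp add: cis_divide[symmetric] scaleR_conv_of_real)
  moreover have "Arg2pi (cis (t - s)) = t - s"
    using assms by (intro Arg2pi_unique[of 1]) (auto simp: cis_conv_exp)
  ultimately show ?thesis
    by (simp add: ccw_angle_def)
qed

lemma cis_plus_2pi: "cis (t + 2 * pi) = cis t"
  by (simp add: complex_eq_iff)

text \<open>Lifts a point of the circle to a real angle measured from \<open>s\<close>, so that
  circular order becomes order of reals.\<close>

lemma sphere_eq_cis_ccw_angle:
  assumes "0 < r" "Q \<in> sphere Z r"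
  shows "Q = Z + r *\<^sub>R cis (s + ccw_angle Z (Z + r *\<^sub>R cis s) Q)"
proof -
  define w where "w = (Q - Z) / (r *\<^sub>R cis s)"
  have "norm w = 1"
    using assms by (simp add: w_def norm_divide dist_norm norm_minus_commute)
  then have "w = cis (Arg2pi w)"
    using Arg2pi_eq[of w] by (simp add: cis_conv_exp)
  moreover have "Q = Z + w * (r *\<^sub>R cis s)"
    using assms by (simp add: w_def scaleR_conv_of_real)
  ultimately have "Q = Z + cis (Arg2pi w) * (r *\<^sub>R cis s)"
    by metis
  moreover have "ccw_angle Z (Z + r *\<^sub>R cis s) Q = Arg2pi w"
    by (simp add: ccw_angle_def w_def)
  ultimately show ?thesis
    by (simp add: cis_mult[symmetric] scaleR_conv_of_real mult_ac)
qed

lemma inner_cis_cis: "cis s \<bullet> cis t = cos (s - t)"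
  by (simp add: inner_complex_def cos_diff algebra_simps)

text \<open>With \<open>X = D + \<rho> *\<^sub>R cis t\<close>, the support functions in direction
  \<open>cis x\<close> differ by \<open>\<rho> * cos (x - t) + r - rd\<close>. Hence
  \<open>x\<close> reaches as far as \<open>d\<close> on an arc about \<open>t\<close> of half-width
  \<open>p = arccos ((rd - r) / \<rho>)\<close>, with the touching points at its ends.\<close>

lemma disc_arc:
  assumes r: "0 \<le> r" "0 < rd"
    and X0: "X0 \<in> ray_through D X" "X0 = D + rd *\<^sub>R cis t"
    and tan: "tangent_points (cball X r) (cball D rd) = {X1, X2}"
    and ord: "ccw_order D X1 X0 X2"
  obtains p where "0 < p" "p < pi" "X1 = D + rd *\<^sub>R cis (t - p)" "X2 = D + rd *\<^sub>R cis (t + p)"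
    "\<And>x. cis x \<bullet> D + rd \<le> cis x \<bullet> X + r \<longleftrightarrow> cos p \<le> cos (x - t)"
proof -
  obtain m where m: "rd *\<^sub>R cis t = m *\<^sub>R (X - D)" "0 \<le> m"
    using X0 unfolding ray_through_def by auto
  have "m \<noteq> 0"
    using m r by auto
  \<comment> \<open>This is the distance from \<open>D\<close> to \<open>X\<close>, obtained by
    inverting the ray parameter \<open>m\<close>.\<close>
  define \<rho> where "\<rho> = rd / m"
  have "0 < \<rho>"
    using m \<open>m \<noteq> 0\<close> r by (simp add: \<rho>_def)
  have "\<rho> *\<^sub>R cis t = inverse m *\<^sub>R (rd *\<^sub>R cis t)"
    by (simp add: \<rho>_def divide_inverse_commute)
  also have "\<dots> = X - D"
    using m \<open>m \<noteq> 0\<close> by simp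
  finally have X: "X = D + \<rho> *\<^sub>R cis t"
    by simp
  define s where "s = (rd - r) / \<rho>"
  have height: "cis x \<bullet> X = cis x \<bullet> D + \<rho> * cos (x - t)" for x
    by (simp add: X inner_add_right inner_cis_cis)
  have le: "cis x \<bullet> D + rd \<le> cis x \<bullet> X + r \<longleftrightarrow> s \<le> cos (x - t)" for x
    using \<open>0 < \<rho>\<close> by (auto simp: height s_def field_simps)
  have eq: "cis x \<bullet> X + r = cis x \<bullet> D + rd \<longleftrightarrow> cos (x - t) = s" for x
    using \<open>0 < \<rho>\<close> by (auto simp: height s_def field_simps)
  have "{D + rd *\<^sub>R e | e. norm e = 1 \<and> e \<bullet> X + r = e \<bullet> D + rd} =
      {D + rd *\<^sub>R cis x | x. cos (x - t) = s}"
    by (smt (verit) Collect_cong eq norm_cis complex_norm_eq_1_exp cis_conv_exp)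
  then have pts: "{X1, X2} = {D + rd *\<^sub>R cis x | x. cos (x - t) = s}"
    using tan tangent_points_cball[of r rd X D] r by simp
  \<comment> \<open>Existence of a touching point puts \<open>s\<close> in the range of cosine, as
    \<open>arccos\<close> requires.\<close>
  then obtain x1 where "cos (x1 - t) = s"
    by blast
  then have s: "-1 \<le> s" "s \<le> 1"
    using cos_ge_minus_one cos_le_one by metis+
  define p where "p = arccos s"
  have p: "0 \<le> p" "p \<le> pi" "cos p = s"
    using s by (auto simp: p_def arccos_lbound arccos_ubound)
  have "D + rd *\<^sub>R cis (t + p) \<in> {X1, X2}" "D + rd *\<^sub>R cis (t - p) \<in> {X1, X2}"
    unfolding pts using p by (auto intro!: exI)
  moreover have "Y \<in> {D + rd *\<^sub>R cis (t + p), D + rd *\<^sub>R cis (t - p)}"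
    if Y_in: "Y \<in> {X1, X2}" for Y
  proof -
    obtain x where Y: "Y = D + rd *\<^sub>R cis x" and "cos (x - t) = s"
      using Y_in unfolding pts by blast
    then have "cos (x - t) = cos p"
      using p by simp
    then have "(sin (x - t))\<^sup>2 = (sin p)\<^sup>2"
      by (simp add: sin_squared_eq)
    then have "cis (x - t) = cis p \<or> cis (x - t) = cis (- p)"
      using \<open>cos (x - t) = cos p\<close> by (auto simp: power2_eq_iff complex_eq_iff)
    then have "cis t * cis (x - t) = cis t * cis p \<or> cis t * cis (x - t) = cis t * cis (- p)"
      by auto
    then have "cis x = cis (t + p) \<or> cis x = cis (t - p)"
      by (simp add: cis_mult)
    then show ?thesis
      using Y by auto
  qed
  ultimately have set: "{X1, X2} = {D + rd *\<^sub>R cis (t + p), D + rd *\<^sub>R cis (t - p)}"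
    by blast
  \<comment> \<open>For \<open>p = 0\<close> or \<open>p = pi\<close> the two ends of the arc would
    coincide, which the strict order excludes.\<close>
  have "X1 \<noteq> X2"
    using ord by (auto simp: ccw_order_def ccw_angle_self)
  then have "cis (t + p) \<noteq> cis (t - p)"
    using set by auto
  then have "p \<noteq> 0"
    by auto
  moreover have "p \<noteq> pi"
    using \<open>cis (t + p) \<noteq> cis (t - p)\<close> by (auto simp: complex_eq_iff)
  ultimately have p': "0 < p" "p < pi"
    using p by auto
  \<comment> \<open>With the ends swapped, the walk from \<open>X1\<close> would meet
    \<open>X2\<close> after \<open>2 * pi - 2 * p\<close>, before \<open>X0\<close> at
    \<open>2 * pi - p\<close>.\<close>
  have "X1 \<noteq> D + rd *\<^sub>R cis (t + p)"
  proof
    assume X1: "X1 = D + rd *\<^sub>R cis (t + p)"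
    then have "X2 = D + rd *\<^sub>R cis (t - p + 2 * pi)"
      unfolding cis_plus_2pi using set \<open>X1 \<noteq> X2\<close> by (auto simp: doubleton_eq_iff)
    moreover have "X0 = D + rd *\<^sub>R cis (t + 2 * pi)"
      using X0 by (simp add: cis_plus_2pi)
    ultimately show False
      using ord p' r unfolding ccw_order_def X1 by (simp add: ccw_angle_cis)
  qed
  then have "X1 = D + rd *\<^sub>R cis (t - p)" "X2 = D + rd *\<^sub>R cis (t + p)"
    using set \<open>X1 \<noteq> X2\<close> by (auto simp: doubleton_eq_iff)
  then show thesis
    using that p' le p by simp
qed

section \<open>From the tight implication to a minimal arc cover\<close>

lemma circ_implies_iff:
  assumes "finite I" "I \<noteq> {}" "\<And>X r. (X, r) \<in> I \<Longrightarrow> 0 \<le> r" "0 \<le> rd"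
  shows "circ_implies ((\<lambda>(X, r). cball X r) ` I) (cball D rd) \<longleftrightarrow>
    (\<forall>x. \<exists>(X, r)\<in>I. cis x \<bullet> D + rd \<le> cis x \<bullet> X + r)"
proof -
  have "(\<forall>e. norm e = 1 \<longrightarrow> P e) \<longleftrightarrow> (\<forall>x. P (cis x))" for P
    by (metis norm_cis complex_norm_eq_1_exp cis_conv_exp)
  then show ?thesis
    unfolding circ_implies_def using cball_subset_convex_hull_iff[OF assms] by simp
qed

theorem theorem4p12:
  fixes A B C D :: complex and ra rb rc rd :: real
    and a b c d :: "complex set"
    and A0 A1 A2 B0 B1 B2 C0 C1 C2 :: complex
  assumes "0 \<le> ra" and "a = cball A ra"
    and "0 \<le> rb" and "b = cball B rb"
    and "0 \<le> rc" and "c = cball C rc"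
    and "0 \<le> rd" and "d = cball D rd"
    and "circ_implies_tight {a, b, c} d"
    and "A0 \<in> ray_through D A \<inter> sphere D rd"
    and "B0 \<in> ray_through D B \<inter> sphere D rd"
    and "C0 \<in> ray_through D C \<inter> sphere D rd"
    and "tangent_points a d = {A1, A2}"
    and "tangent_points b d = {B1, B2}"
    and "tangent_points c d = {C1, C2}"
    and "ccw_order D B0 A0 C0"
    and "ccw_order D B1 B0 B2"
    and "ccw_order D A1 A0 A2"
    and "ccw_order D C2 C0 C1"
  shows "ccw_order6 D B1 C1 A1 B2 C2 A2"
proof -
  note discs = \<open>a = cball A ra\<close> \<open>b = cball B rb\<close> \<open>c = cball C rc\<close> \<open>d = cball D rd\<close>
  note radii = \<open>0 \<le> ra\<close> \<open>0 \<le> rb\<close> \<open>0 \<le> rc\<close> \<open>0 \<le> rd\<close>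
  note order0 = \<open>ccw_order D B0 A0 C0\<close>
  note ray = \<open>A0 \<in> ray_through D A \<inter> sphere D rd\<close> \<open>B0 \<in> ray_through D B \<inter> sphere D rd\<close>
    \<open>C0 \<in> ray_through D C \<inter> sphere D rd\<close>
  \<comment> \<open>For \<open>c\<close> the counterclockwise first end is \<open>C2\<close>, hence
    the swapped pair.\<close>
  have tangents: "tangent_points (cball A ra) (cball D rd) = {A1, A2}"
    "tangent_points (cball B rb) (cball D rd) = {B1, B2}"
    "tangent_points (cball C rc) (cball D rd) = {C2, C1}"
    using assms by (simp_all add: insert_commute)
  have "rd \<noteq> 0"
    using order0 ray by (auto simp: ccw_order_def ccw_angle_self)
  then have rd: "0 < rd"
    using radii by simp
  \<comment> \<open>The direction 0 is an arbitrary reference; measuring the other two angles from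
    \<open>B0\<close> places all three centres in one turn.\<close>
  define \<beta> where "\<beta> = ccw_angle D (D + rd *\<^sub>R cis 0) B0"
  define \<alpha> where "\<alpha> = \<beta> + ccw_angle D B0 A0"
  define \<gamma> where "\<gamma> = \<beta> + ccw_angle D B0 C0"
  have B0: "B0 = D + rd *\<^sub>R cis \<beta>"
    using sphere_eq_cis_ccw_angle[OF rd, of B0 D 0] ray by (simp add: \<beta>_def)
  have A0: "A0 = D + rd *\<^sub>R cis \<alpha>" and C0: "C0 = D + rd *\<^sub>R cis \<gamma>"
    using sphere_eq_cis_ccw_angle[OF rd, of _ D \<beta>] ray by (simp_all add: \<alpha>_def \<gamma>_def B0[symmetric])
  have angles: "\<beta> < \<alpha>" "\<alpha> < \<gamma>" "\<gamma> < \<beta> + 2 * pi"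
    using order0 Arg2pi_lt_2pi by (auto simp: \<alpha>_def \<gamma>_def ccw_order_def ccw_angle_def)
  obtain p where p: "0 < p" "p < pi" "B1 = D + rd *\<^sub>R cis (\<beta> - p)" "B2 = D + rd *\<^sub>R cis (\<beta> + p)"
    and arc_b: "\<And>x. cis x \<bullet> D + rd \<le> cis x \<bullet> B + rb \<longleftrightarrow> cos p \<le> cos (x - \<beta>)"
    by (rule disc_arc[OF radii(2) rd IntD1[OF ray(2)] B0 tangents(2) \<open>ccw_order D B1 B0 B2\<close>]) blast
  obtain q where q: "0 < q" "q < pi" "A1 = D + rd *\<^sub>R cis (\<alpha> - q)" "A2 = D + rd *\<^sub>R cis (\<alpha> + q)"
    and arc_a: "\<And>x. cis x \<bullet> D + rd \<le> cis x \<bullet> A + ra \<longleftrightarrow> cos q \<le> cos (x - \<alpha>)"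
    by (rule disc_arc[OF radii(1) rd IntD1[OF ray(1)] A0 tangents(1) \<open>ccw_order D A1 A0 A2\<close>]) blast
  obtain r where r: "0 < r" "r < pi" "C2 = D + rd *\<^sub>R cis (\<gamma> - r)" "C1 = D + rd *\<^sub>R cis (\<gamma> + r)"
    and arc_c: "\<And>x. cis x \<bullet> D + rd \<le> cis x \<bullet> C + rc \<longleftrightarrow> cos r \<le> cos (x - \<gamma>)"
    by (rule disc_arc[OF radii(3) rd IntD1[OF ray(3)] C0 tangents(3) \<open>ccw_order D C2 C0 C1\<close>]) blast
  \<comment> \<open>Distinctness ensures that removing one disc from the set leaves the other two.
    Equal discs would share a centre, hence a ray and its point on the circle.\<close>
  have ne: "a \<noteq> b" "a \<noteq> c" "b \<noteq> c"
  proof -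
    have "A0 \<noteq> B0" "B0 \<noteq> C0" "A0 \<noteq> C0"
      using order0 by (auto simp: ccw_order_def ccw_angle_self)
    moreover have "X0 = Y0" if "X0 \<in> ray_through D X \<inter> sphere D rd"
      "Y0 \<in> ray_through D X \<inter> sphere D rd" for X X0 Y0
      using that rd unfolding ray_through_def by (auto simp: dist_norm)
    ultimately show "a \<noteq> b" "a \<noteq> c" "b \<noteq> c"
      using ray radii unfolding discs cball_eq_cball_iff by (metis not_less)+
  qed
  have sets: "{a, b, c} = (\<lambda>(X, r). cball X r) ` {(A, ra), (B, rb), (C, rc)}"
    "{a, b, c} - {a} = (\<lambda>(X, r). cball X r) ` {(B, rb), (C, rc)}"
    "{a, b, c} - {b} = (\<lambda>(X, r). cball X r) ` {(A, ra), (C, rc)}"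
    "{a, b, c} - {c} = (\<lambda>(X, r). cball X r) ` {(A, ra), (B, rb)}"
    using ne discs by auto
  have iff: "circ_implies ((\<lambda>(X, r). cball X r) ` I) d \<longleftrightarrow>
      (\<forall>x. \<exists>(X, r)\<in>I. cis x \<bullet> D + rd \<le> cis x \<bullet> X + r)"
    if "I \<noteq> {}" "I \<subseteq> {(A, ra), (B, rb), (C, rc)}" for I
    unfolding discs using that radii by (intro circ_implies_iff) (auto intro: finite_subset)
  have tight: "circ_implies {a, b, c} d" "\<not> circ_implies ({a, b, c} - {a}) d"
    "\<not> circ_implies ({a, b, c} - {b}) d" "\<not> circ_implies ({a, b, c} - {c}) d"
    using \<open>circ_implies_tight {a, b, c} d\<close> by (simp_all add: circ_implies_tight_def)
  have cover: "cos p \<le> cos (x - \<beta>) \<or> cos q \<le> cos (x - \<alpha>) \<or> cos r \<le> cos (x - \<gamma>)" for x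
    using tight(1) iff[of "{(A, ra), (B, rb), (C, rc)}"] unfolding sets(1)
    by (auto simp: arc_a arc_b arc_c)
  have gaps: "\<exists>x. \<not> cos p \<le> cos (x - \<beta>) \<and> \<not> cos r \<le> cos (x - \<gamma>)"
    "\<exists>x. \<not> cos q \<le> cos (x - \<alpha>) \<and> \<not> cos r \<le> cos (x - \<gamma>)"
    "\<exists>x. \<not> cos p \<le> cos (x - \<beta>) \<and> \<not> cos q \<le> cos (x - \<alpha>)"
    using tight(2)[unfolded sets(2)] iff[of "{(B, rb), (C, rc)}"]
      tight(3)[unfolded sets(3)] iff[of "{(A, ra), (C, rc)}"]
      tight(4)[unfolded sets(4)] iff[of "{(A, ra), (B, rb)}"]
    by (auto simp: arc_a arc_b arc_c)
  have shift: "cos (x - (t + 2 * pi)) = cos (x - t)" for x t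
    using cos_int_shift[of x 1 t] by (simp add: algebra_simps)
  \<comment> \<open>One instance for each cyclically consecutive pair; centres that come round again
    are raised by \<open>2 * pi\<close>, which \<open>shift\<close> removes from the
    cosines.\<close>
  have ba: "\<alpha> - q \<le> \<beta> + p" "\<alpha> + q < \<beta> - p + 2 * pi"
    using minimal_arc_cover[of \<beta> \<alpha> \<gamma> p q r] angles p q r cover gaps by blast+
  have ac: "\<gamma> - r \<le> \<alpha> + q" "\<gamma> + r < \<alpha> - q + 2 * pi"
    using minimal_arc_cover[of \<alpha> \<gamma> "\<beta> + 2 * pi" q r p, unfolded shift] angles p q r cover gaps
    by (simp_all, blast+)
  have cb: "\<beta> + 2 * pi - p \<le> \<gamma> + r" "\<beta> + 2 * pi + p < \<gamma> - r + 2 * pi"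
    using minimal_arc_cover[of \<gamma> "\<beta> + 2 * pi" "\<alpha> + 2 * pi" r p q, unfolded shift]
      angles p q r cover gaps
    by (simp_all, blast+)
  \<comment> \<open>Lowering \<open>C1\<close> by a full turn puts all six points in the turn
    starting at \<open>B1\<close>. The inequalities chain to \<open>\<beta> - p \<le> \<gamma> + r -
    2 * pi < \<alpha> - q \<le> \<beta> + p < \<gamma> - r \<le> \<alpha> + q < \<beta> - p + 2 *
    pi\<close>.\<close>
  have "C1 = D + rd *\<^sub>R cis (\<gamma> + r - 2 * pi)"
    using r cis_plus_2pi[of "\<gamma> + r - 2 * pi"] by simp
  then show ?thesis
    using p q r ba ac cb rd unfolding ccw_order6_def by (simp add: ccw_angle_cis)
qed

end
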